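(* Let $G$ be an $r$-regular graph of order $n$ and diameter $2$. Let $\sigma(\mathcal{L}(G))=\{\mu_1,\mu_2,\dots,\mu_n\}$ with corresponding (linearly independent) eigenvectors $\mathbf{u}_1,\mathbf{u}_2,\dots,\mathbf{u}_n=\mathbf{1}$ (so $\mu_n=0$), and let $\sigma(\mathcal{Q}(G))=\{q_1,q_2,\dots,q_n\}$ with corresponding (linearly independent) eigenvectors $\mathbf{1}=\mathbf{q}_1,\mathbf{q}_2,\dots,\mathbf{q}_n$ (so $q_1=2r$). Then the following hold. (i) $\sigma(\mathcal{E}^{\mathcal{L}}(G\vee K_1))=\{2n+1-2\mu_1,\,2n+1-2\mu_2,\dots,2n+1-2\mu_{n-1},\,0,\,n+1\}$ (with multiplicity). Moreover, $\begin{bmatrix}\mathbf{u}_1\\0\end{bmatrix},\begin{bmatrix}\mathbf{u}_2\\0\end{bmatrix},\dots,\begin{bmatrix}\mathbf{u}_{n-1}\\0\end{bmatrix},\begin{bmatrix}\mathbf{u}_n\\1\end{bmatrix},\begin{bmatrix}\mathbf{u}_n\\-n\end{bmatrix}$ are the corresponding eigenvectors of $\mathcal{E}^{\mathcal{L}}(G\vee K_1)$, in this order. (ii) $\sigma(\mathcal{E}^{\mathcal{Q}}(G\vee K_1))=\{2n-3-2q_2,\,2n-3-2q_3,\dots,2n-3-2q_n,\,t_1,\,t_2\}$ (with multiplicity), where $t_1$ and $t_2$ are the zeros of the quadratic polynomial $t^2-(5n-4r-3)t+4n(n-r-1)$. Furthermore, $\begin{bmatrix}\mathbf{q}_2\\0\end{bmatrix},\begin{bmatrix}\mathbf{q}_3\\0\end{bmatrix},\dots,\begin{bmatrix}\mathbf{q}_n\\0\end{bmatrix},\begin{bmatrix}\mathbf{q}_1\\\alpha_1\end{bmatrix},\begin{bmatrix}\mathbf{q}_1\\\alpha_2\end{bmatrix}$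 are the corresponding eigenvectors of $\mathcal{E}^{\mathcal{Q}}(G\vee K_1)$, in this order, where $\alpha_1=\frac{n}{t_1-n}$ and $\alpha_2=-\frac{n}{\alpha_1}$.
   Context: Graphs are finite, simple and undirected. $\mathcal{A}(G)$ is the adjacency matrix, $\mathcal{L}(G)=\mathrm{Diag}(\mathrm{Deg}(G))-\mathcal{A}(G)$ the Laplacian and $\mathcal{Q}(G)=\mathrm{Diag}(\mathrm{Deg}(G))+\mathcal{A}(G)$ the signless Laplacian, where $\mathrm{Diag}(\mathrm{Deg}(G))$ is the diagonal matrix of vertex degrees. $\sigma(A)$ is the spectrum of $A$ (with multiplicity) and $\mathbf{1}$ is the all-ones vector. $G\vee K_1$ is the join of $G$ with a single vertex (a new vertex adjacent to all vertices of $G$); its vertices are ordered with the vertices of $G$ first and the new vertex last. For a connected graph $H$ with vertices $v_1,\dots,v_m$, $d(v_i,v_j)$ is the length of a shortest path and $e(v_i)=\max_j d(v_i,v_j)$. The eccentricity matrix $\mathcal{E}(H)$ has entries $\mathcal{E}_{ij}(H)=d(v_i,v_j)$ if $d(v_i,v_j)=\min\{e(v_i),e(v_j)\}$ and $\mathcal{E}_{ij}(H)=0$ if $d(v_i,v_j)<\min\{e(v_i),e(v_j)\}$. Put $\mathrm{Tr}_{\mathcal{E}}(v_i)=\sum_j\mathcal{E}_{ij}(H)$ and let $\mathrm{Diag}(\mathrm{Tr}_{\mathcal{E}}(H))$ be the diagonal matrix of these numbers. Then $\mathcal{E}^{\mathcal{L}}(H)=\mathrm{Diag}(\mathrm{Tr}_{\mathcal{E}}(H))-\mathcal{E}(H)$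 and $\mathcal{E}^{\mathcal{Q}}(H)=\mathrm{Diag}(\mathrm{Tr}_{\mathcal{E}}(H))+\mathcal{E}(H)$. *)

theory Defs
  imports
    "Graph_Theory.Shortest_Path"
    "Graph_Theory.Pair_Digraph"
    "Jordan_Normal_Form.Char_Poly"
    "Jordan_Normal_Form.VS_Connect"
begin

text \<open>
  Finite simple undirected graphs are represented by the locale \<^locale>\<open>pair_graph\<close>:
  \<^term>\<open>parcs G\<close> is a symmetric, irreflexive relation containing both orientations of every
  edge, so the degree of a vertex is its out-degree. Matrices of a graph are taken with respect
  to an enumeration \<open>vs\<close> of its vertices.
\<close>

definition regular :: "nat \<Rightarrow> 'a pair_pre_digraph \<Rightarrow> bool" where
  "regular r G \<longleftrightarrow> (\<forall>v \<in> pverts G. out_degree G v = r)"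

text \<open>With unit weights \<open>\<mu>\<close> is the minimal number of edges of a walk, and \<open>\<infinity>\<close> if there is none.\<close>

definition gdist :: "'a pair_pre_digraph \<Rightarrow> 'a \<Rightarrow> 'a \<Rightarrow> ereal" where
  "gdist G u v = wf_digraph.\<mu> G (\<lambda>_. 1) u v"

definition ecc :: "'a pair_pre_digraph \<Rightarrow> 'a \<Rightarrow> ereal" where
  "ecc G v = (SUP w \<in> pverts G. gdist G v w)"

definition diameter :: "'a pair_pre_digraph \<Rightarrow> ereal" where
  "diameter G = (SUP v \<in> pverts G. ecc G v)"

definition graph_join ::
  "'a pair_pre_digraph \<Rightarrow> 'b pair_pre_digraph \<Rightarrow> ('a + 'b) pair_pre_digraph" where
  "graph_join G H =
    \<lparr> pverts = pverts G <+> pverts H,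
      parcs = map_prod Inl Inl ` parcs G \<union> map_prod Inr Inr ` parcs H
        \<union> Inl ` pverts G \<times> Inr ` pverts H \<union> Inr ` pverts H \<times> Inl ` pverts G \<rparr>"

definition K1 :: "unit pair_pre_digraph" where
  "K1 = \<lparr> pverts = {()}, parcs = {} \<rparr>"

definition adj_mat :: "'a pair_pre_digraph \<Rightarrow> 'a list \<Rightarrow> real mat" where
  "adj_mat G vs = mat (length vs) (length vs)
     (\<lambda>(i, j). if (vs ! i, vs ! j) \<in> parcs G then 1 else 0)"

definition deg_mat :: "'a pair_pre_digraph \<Rightarrow> 'a list \<Rightarrow> real mat" where
  "deg_mat G vs = mat (length vs) (length vs)
     (\<lambda>(i, j). if i = j then real (out_degree G (vs ! i)) else 0)"

definition laplacian :: "'a pair_pre_digraph \<Rightarrow> 'a list \<Rightarrow> real mat" where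
  "laplacian G vs = deg_mat G vs - adj_mat G vs"

definition signless_laplacian :: "'a pair_pre_digraph \<Rightarrow> 'a list \<Rightarrow> real mat" where
  "signless_laplacian G vs = deg_mat G vs + adj_mat G vs"

definition ecc_mat :: "'a pair_pre_digraph \<Rightarrow> 'a list \<Rightarrow> real mat" where
  "ecc_mat G vs = mat (length vs) (length vs)
     (\<lambda>(i, j). if gdist G (vs ! i) (vs ! j) = min (ecc G (vs ! i)) (ecc G (vs ! j))
               then real_of_ereal (gdist G (vs ! i) (vs ! j)) else 0)"

definition ecc_transmission_mat :: "'a pair_pre_digraph \<Rightarrow> 'a list \<Rightarrow> real mat" where
  "ecc_transmission_mat G vs = mat (length vs) (length vs)
     (\<lambda>(i, j). if i = j then (\<Sum>k < length vs. ecc_mat G vs $$ (i, k)) else 0)"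

definition ecc_laplacian :: "'a pair_pre_digraph \<Rightarrow> 'a list \<Rightarrow> real mat" where
  "ecc_laplacian G vs = ecc_transmission_mat G vs - ecc_mat G vs"

definition ecc_signless_laplacian :: "'a pair_pre_digraph \<Rightarrow> 'a list \<Rightarrow> real mat" where
  "ecc_signless_laplacian G vs = ecc_transmission_mat G vs + ecc_mat G vs"

text \<open>
  The spectrum with multiplicity. Only real roots are counted; the matrices above are
  symmetric, so for them these are all the roots of the characteristic polynomial.
\<close>

definition mspectrum :: "real mat \<Rightarrow> real multiset" where
  "mspectrum A = proots (char_poly A)"

text \<open>Linear independence of a family (not just of its set of members), hence \<^const>\<open>distinct\<close>.\<close>

definition lin_indpt_family :: "nat \<Rightarrow> real vec list \<Rightarrow> bool" where
  "lin_indpt_family n xs \<longleftrightarrow> set xs \<subseteq> carrier_vec n \<and> distinct xs \<and>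
     module.lin_indpt class_ring (module_vec TYPE(real) n) (set xs)"

text \<open>
  \<open>es\<close> is the spectrum of \<open>A\<close> with multiplicity and \<open>xs\<close> are corresponding linearly independent
  eigenvectors, the \<open>i\<close>-th vector belonging to the \<open>i\<close>-th eigenvalue.
\<close>

definition eigensystem :: "real mat \<Rightarrow> real list \<Rightarrow> real vec list \<Rightarrow> bool" where
  "eigensystem A es xs \<longleftrightarrow> mspectrum A = mset es \<and>
     list_all2 (eigenvector A) xs es \<and> lin_indpt_family (dim_row A) xs"

abbreviation ones_vec :: "nat \<Rightarrow> real vec" where
  "ones_vec n \<equiv> vec n (\<lambda>_. 1)"

definition extend_vec :: "real vec \<Rightarrow> real \<Rightarrow> real vec" where
  "extend_vec v a = v @\<^sub>v vec_of_list [a]"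

end

theory Submission
  imports Defs "Jordan_Normal_Form.DL_Rank"
begin

text \<open>
  Write $A$ for the adjacency matrix of $G$ and $H$ for the cone $G \vee K_1$. A regular graph of
  diameter 2 has no vertex adjacent to all others, since by regularity it would then be complete.
  So in $H$ every old vertex has eccentricity 2 and the apex has eccentricity 1, and the
  eccentricity matrix of $H$ is
  $2(J - I - A)$ bordered by a row and a column of ones with a zero in the corner
  (\<open>ecc_mat_cone_index\<close>). Its row sums are $2n - 2r - 1$ at the old vertices and $n$ at the apex.

  Regularity gives $L = rI - A$ and $Q = rI + A$, so eigenvectors of $L$ or $Q$ are eigenvectors
  of $A$, and everything can be computed from $A$. On a vector $(x, 0)$ with $Ax = kx$ and entry
  sum 0, the matrix $J$ and the border vanish, and $(x, 0)$ is an eigenvector of both matrices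
  of $H$ (\<open>cone_eigenvector_base\<close>). Every listed $x$ other than $\mathbf{1}$ has entry sum 0:
  as all column sums of $A$ are $r$, this can only fail for $k = r$, and then $x$ is harmonic on
  a connected graph, hence a multiple of $\mathbf{1}$ (\<open>adj_eigenvector_sum_zero\<close>), which linear
  independence excludes.

  The remaining two eigenvectors have the form $(\mathbf{1}, s)$: the span of these vectors is
  invariant, and on it the eigenvalue equation becomes a quadratic in $s$
  (\<open>cone_eigenvector_ones\<close>). For the signless matrix, $p(n) = -n < 0$ for the quadratic $p$ of
  the theorem; this gives at once two real zeros, $t_1, t_2 \neq n$, and
  $(t_1 - n)(t_2 - n) = -n$, which is why $\alpha_2 = -n/\alpha_1$ belongs to $t_2$.

  The $n + 1$ vectors so obtained are linearly independent (\<open>lin_indpt_family_extend\<close>), so they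
  diagonalise the matrix, and its spectrum with multiplicity is the list of their eigenvalues
  (\<open>eigensystemI\<close>).
\<close>

section \<open>Independent families and diagonalisation\<close>

lemma mat_of_cols_mult_index:
  fixes c :: "'a::comm_semiring_0 vec"
  assumes "k < n" "dim_vec c = length xs"
  shows "(mat_of_cols n xs *\<^sub>v c) $ k = (\<Sum>i<length xs. c $ i * xs ! i $ k)"
  using assms by (auto simp: scalar_prod_def mat_of_cols_index atLeast0LessThan mult.commute
      intro!: sum.cong)

text \<open>
  Membership in a family is by position here, so a repeated member yields the relation
  $x_i - x_j = 0$; this is how the coordinate condition also captures distinctness.
\<close>
lemma lin_indpt_family_iff:
  assumes carr: "set xs \<subseteq> carrier_vec n"
  shows "lin_indpt_family n xs \<longleftrightarrow>
    (\<forall>c. (\<forall>k<n. (\<Sum>i<length xs. c i * xs ! i $ k) = 0) \<longrightarrow> (\<forall>i<length xs. c i = 0))"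
    (is "?L \<longleftrightarrow> ?R")
proof
  interpret vec_space "TYPE(real)" n .
  let ?A = "mat_of_cols n xs"
  have A: "?A \<in> carrier_mat n (length xs)" by simp
  have colsA: "cols ?A = xs" using carr by simp
  show ?R if L: ?L
  proof (intro allI impI)
    fix c :: "nat \<Rightarrow> real" and i
    assume c: "\<forall>k<n. (\<Sum>i<length xs. c i * xs ! i $ k) = 0" and i: "i < length xs"
    let ?v = "vec (length xs) c"
    have "?A *\<^sub>v ?v = 0\<^sub>v n"
      by (rule eq_vecI) (auto simp: mat_of_cols_mult_index c simp del: index_mult_mat_vec)
    then have "?v = 0\<^sub>v (length xs)"
      using lin_depI[OF A, of ?v] L colsA unfolding lin_indpt_family_def by auto
    then show "c i = 0" using i by (metis index_vec index_zero_vec(1))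
  qed
  show ?L if R: ?R
    unfolding lin_indpt_family_def
  proof (intro conjI carr)
    show dist: "distinct xs"
    proof (rule ccontr)
      assume "\<not> distinct xs"
      then obtain i j where ij: "i < length xs" "j < length xs" "i \<noteq> j" "xs ! i = xs ! j"
        by (auto simp: distinct_conv_nth)
      let ?c = "\<lambda>l. (if l = i then 1 else 0) - (if l = j then 1 else (0::real))"
      have "(\<Sum>l<length xs. ?c l * xs ! l $ k) = 0" for k
        using ij by (simp add: left_diff_distrib sum_subtractf if_distrib[where f="\<lambda>a. a * _"]
            sum.delta cong: if_cong)
      then have "?c i = 0" using R[rule_format, of ?c i] ij(1) by blast
      then show False using ij by simp
    qed
    show "lin_indpt (set xs)"
    proof
      assume "lin_dep (set xs)"
      then obtain v where v: "v \<in> carrier_vec (length xs)" "v \<noteq> 0\<^sub>v (length xs)" "?A *\<^sub>v v = 0\<^sub>v n"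
        using lin_depE[OF A] colsA dist by metis
      have "(\<Sum>i<length xs. v $ i * xs ! i $ k) = 0" if "k < n" for k
        using mat_of_cols_mult_index[OF that, of v xs] v that by (simp del: index_mult_mat_vec)
      then have "\<forall>i<length xs. v $ i = 0" using R[rule_format, of "\<lambda>i. v $ i"] by blast
      then have "v = 0\<^sub>v (length xs)" using v(1) by (intro eq_vecI) auto
      then show False using v(2) by simp
    qed
  qed
qed

lemma lin_indpt_familyD:
  assumes "lin_indpt_family n xs"
    and "\<And>k. k < n \<Longrightarrow> (\<Sum>i<length xs. c i * xs ! i $ k) = 0"
    and "i < length xs"
  shows "c i = 0"
proof -
  have "set xs \<subseteq> carrier_vec n" using assms(1) by (simp add: lin_indpt_family_def)
  note iffD1[OF lin_indpt_family_iff[OF this] assms(1), THEN spec, of c]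
  moreover have "\<forall>k<n. (\<Sum>i<length xs. c i * xs ! i $ k) = 0"
    by (intro allI impI) (fact assms(2))
  ultimately show ?thesis using assms(3) by (simp only:)
qed

lemma lin_indpt_family_mset_cong:
  "mset xs = mset ys \<Longrightarrow> lin_indpt_family n xs \<longleftrightarrow> lin_indpt_family n ys"
  unfolding lin_indpt_family_def using mset_eq_setD[of xs ys] mset_eq_imp_distinct_iff[of xs ys]
  by simp

lemma lin_indpt_family_not_multiple:
  assumes ind: "lin_indpt_family n xs" and ij: "i < length xs" "j < length xs" "i \<noteq> j"
  shows "xs ! i \<noteq> a \<cdot>\<^sub>v xs ! j"
proof
  assume eq: "xs ! i = a \<cdot>\<^sub>v xs ! j"
  have carr: "set xs \<subseteq> carrier_vec n" using ind by (simp add: lin_indpt_family_def)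
  let ?c = "\<lambda>l. (if l = i then 1 else 0) - (if l = j then a else 0)"
  have dim: "dim_vec (xs ! j) = n" using carr nth_mem[OF ij(2)] by auto
  have "(\<Sum>l<length xs. ?c l * xs ! l $ k) = 0" if "k < n" for k
  proof -
    have "(\<Sum>l<length xs. ?c l * xs ! l $ k) = (\<Sum>l<length xs.
        (if l = i then xs ! i $ k else 0) - (if l = j then a * xs ! j $ k else 0))"
      using ij(3) by (intro sum.cong) auto
    also have "\<dots> = xs ! i $ k - a * xs ! j $ k"
      using ij by (simp add: sum_subtractf)
    also have "xs ! i $ k = a * xs ! j $ k"
      unfolding eq using that dim by simp
    finally show ?thesis by simp
  qed
  from lin_indpt_familyD[of n xs ?c i, OF ind this ij(1)] have "?c i = 0" .
  then show False using ij by simp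
qed

text \<open>
  The matrix $P$ with the eigenvectors as columns is invertible and $AP = PD$ for the diagonal
  matrix $D$ of eigenvalues. So $A$ is similar to $D$, and its characteristic polynomial splits
  into the corresponding linear factors.
\<close>
lemma eigensystemI:
  assumes A: "A \<in> carrier_mat n n"
    and len: "length xs = n"
    and eig: "list_all2 (eigenvector A) xs es"
    and ind: "lin_indpt_family n xs"
  shows "eigensystem A es xs"
proof -
  define P where "P = mat_of_cols n xs"
  define D where "D = mat_diag n (\<lambda>i. es ! i)"
  have P: "P \<in> carrier_mat n n" using mat_of_cols_carrier(1)[of n xs] len by (simp add: P_def)
  have D: "D \<in> carrier_mat n n" by (simp add: D_def)
  have carr: "set xs \<subseteq> carrier_vec n" using ind by (simp add: lin_indpt_family_def)
  have lene: "length es = n" using eig len by (simp add: list_all2_lengthD)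
  have "v = 0\<^sub>v n" if v: "v \<in> carrier_vec n" "P *\<^sub>v v = 0\<^sub>v n" for v
  proof -
    have "(\<Sum>i<length xs. v $ i * xs ! i $ k) = 0" if "k < n" for k
      using mat_of_cols_mult_index[OF that, of v xs] v that len
      by (simp add: P_def del: index_mult_mat_vec)
    from lin_indpt_familyD[OF ind this] have "\<forall>i<length xs. v $ i = 0" by blast
    then show ?thesis using v(1) len by (intro eq_vecI) auto
  qed
  then have "det P \<noteq> 0" using det_0_iff_vec_prod_zero[OF P] by blast
  from det_non_zero_imp_unit[OF P this, of "()"]
  obtain Q where Q: "Q \<in> carrier_mat n n" and QP: "Q * P = 1\<^sub>m n" and PQ: "P * Q = 1\<^sub>m n"
    unfolding Units_def by (auto simp: ring_mat_simps)
  have AP: "A * P = P * D"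
  proof (rule mat_col_eqI)
    fix j assume "j < dim_col (P * D)"
    then have j: "j < n" using D by simp
    have ev: "eigenvector A (xs ! j) (es ! j)"
      using eig j len by (simp add: list_all2_conv_all_nth)
    have xj: "xs ! j \<in> carrier_vec n" using carr nth_mem[of j xs] j len by auto
    then have colP: "col P j = xs ! j" unfolding P_def using j len by (intro col_mat_of_cols) simp_all
    have "col (P * D) j = es ! j \<cdot>\<^sub>v xs ! j"
    proof (rule eq_vecI)
      fix i assume "i < dim_vec (es ! j \<cdot>\<^sub>v xs ! j)"
      then show "col (P * D) j $ i = (es ! j \<cdot>\<^sub>v xs ! j) $ i"
        unfolding D_def mat_diag_mult_right[OF P] using j len xj
        by (simp add: P_def mat_of_cols_index)
    qed (use P xj in auto)
    then show "col (A * P) j = col (P * D) j"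
      using ev col_mult2[OF A P j] colP by (simp add: eigenvector_def)
  qed (use A P D in auto)
  have "A = P * D * Q"
  proof -
    have "A = A * (P * Q)" using A PQ by simp
    also have "\<dots> = A * P * Q" using A P Q by simp
    finally show ?thesis using AP by simp
  qed
  then have "similar_mat A D"
    by (intro similar_matI[of _ _ P Q n]) (use A P D Q PQ QP in simp_all)
  then have "char_poly A = char_poly D" by (rule char_poly_similar)
  also have "upper_triangular D" by (auto simp: D_def mat_diag_def)
  from char_poly_upper_triangular[OF D this]
  have "char_poly D = (\<Prod>a\<leftarrow>diag_mat D. [:- a, 1:])" .
  also have "diag_mat D = es"
    using lene by (intro nth_equalityI) (auto simp: diag_mat_def D_def mat_diag_def)
  finally have "char_poly A = (\<Prod>a\<leftarrow>es. [:- a, 1:])" .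
  moreover have "proots (\<Prod>a\<leftarrow>es. [:- a, 1:]) = mset es"
  proof (induction es)
    case (Cons a es)
    have "(\<Prod>a\<leftarrow>es. [:- a, 1:]) \<noteq> 0" by (auto simp: prod_list_zero_iff)
    then have "proots ([:- a, 1:] * (\<Prod>a\<leftarrow>es. [:- a, 1:])) = {#a#} + mset es"
      by (subst proots_mult) (simp_all only: Cons.IH proots_linear_factor, auto)
    then show ?case by (simp del: mult_pCons_left mult_pCons_right)
  qed simp
  ultimately have "mspectrum A = mset es" by (simp add: mspectrum_def)
  then show ?thesis using A eig ind by (simp add: eigensystem_def)
qed

lemma dim_extend_vec [simp]: "dim_vec (extend_vec x s) = dim_vec x + 1"
  by (simp add: extend_vec_def)

lemma index_extend_vec [simp]:
  "i < dim_vec x \<Longrightarrow> extend_vec x s $ i = x $ i"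
  "i = dim_vec x \<Longrightarrow> extend_vec x s $ i = s"
  by (auto simp: extend_vec_def)

text \<open>
  Forgetting the last coordinate turns a relation among the extended vectors into one among
  \<open>us @ [v]\<close>, where the coefficient of \<open>v\<close> is the sum of the last two coefficients. That sum
  vanishes, and the last coordinate with \<open>s \<noteq> t\<close> then kills both of them.
\<close>
lemma lin_indpt_family_extend:
  assumes ind: "lin_indpt_family n (us @ [v])" and "s \<noteq> t"
  shows "lin_indpt_family (n + 1)
    (map (\<lambda>x. extend_vec x 0) us @ [extend_vec v s, extend_vec v t])"
proof -
  let ?xs = "map (\<lambda>x. extend_vec x 0) us @ [extend_vec v s, extend_vec v t]"
  let ?m = "length us"
  have carr: "set (us @ [v]) \<subseteq> carrier_vec n" using ind by (simp add: lin_indpt_family_def)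
  then have dims: "\<And>i. i < ?m \<Longrightarrow> dim_vec (us ! i) = n" "dim_vec v = n"
    using nth_mem by fastforce+
  have carr': "set ?xs \<subseteq> carrier_vec (n + 1)" using carr by (auto intro!: carrier_vecI)
  show ?thesis
    unfolding lin_indpt_family_iff[OF carr']
  proof (intro allI impI)
    fix c :: "nat \<Rightarrow> real" and i
    assume c: "\<forall>k<n + 1. (\<Sum>i<length ?xs. c i * ?xs ! i $ k) = 0" and i: "i < length ?xs"
    have split: "(\<Sum>i<?m. c i * extend_vec (us ! i) 0 $ k)
        + c ?m * extend_vec v s $ k + c (Suc ?m) * extend_vec v t $ k = 0" if "k < n + 1" for k
      using c[rule_format, OF that] by (simp add: nth_append)
    define d where "d i = (if i < ?m then c i else c ?m + c (Suc ?m))" for i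
    have "(\<Sum>i<length (us @ [v]). d i * (us @ [v]) ! i $ k) = 0" if "k < n" for k
    proof -
      have "(\<Sum>i<?m. d i * (us @ [v]) ! i $ k) = (\<Sum>i<?m. c i * extend_vec (us ! i) 0 $ k)"
        using that dims by (intro sum.cong) (auto simp: d_def nth_append)
      moreover have "d ?m * v $ k = c ?m * extend_vec v s $ k + c (Suc ?m) * extend_vec v t $ k"
        using that dims by (simp add: d_def distrib_right)
      ultimately show ?thesis using split[of k] that by simp
    qed
    from lin_indpt_familyD[OF ind this] have d: "d i = 0" if "i < ?m + 1" for i
      using that by simp
    have c0: "c i = 0" if "i < ?m" for i using d[of i] that by (simp add: d_def)
    have sum0: "c ?m + c (Suc ?m) = 0" using d[of ?m] by (simp add: d_def)
    have "c ?m * s + c (Suc ?m) * t = 0" using split[of n] dims c0 by simp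
    moreover have "c (Suc ?m) = - c ?m" using sum0 by simp
    ultimately have "c ?m * (s - t) = 0" by (simp add: algebra_simps)
    then have "c ?m = 0" "c (Suc ?m) = 0" using \<open>s \<noteq> t\<close> sum0 by auto
    with c0 i show "c i = 0" by (cases "i < ?m") (auto simp: less_Suc_eq)
  qed
qed

section \<open>Distances and harmonic functions\<close>

lemma (in wf_digraph) awalk_cost_unit: "awalk_cost (\<lambda>_. 1) p = real (length p)"
  by (induction p) auto

context pair_wf_digraph
begin

lemma gdist_le_length: "awalk u p v \<Longrightarrow> gdist G u v \<le> real (length p)"
  using min_cost_le_walk_cost[of u p v "\<lambda>_. 1"]
  by (simp add: gdist_def awalk_cost_unit)

lemma gdist_geI:
  assumes "\<And>p. awalk u p v \<Longrightarrow> m \<le> length p"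
  shows "real m \<le> gdist G u v"
  unfolding gdist_def \<mu>_def awalk_cost_unit
  by (rule INF_greatest) (use assms in simp)

lemma gdist_self: "v \<in> pverts G \<Longrightarrow> gdist G v v = 0"
  using gdist_le_length[of v "[]" v] gdist_geI[of v v 0]
  by (auto simp: awalk_Nil_iff zero_ereal_def intro: antisym)

lemma gdist_arc:
  assumes "(u, v) \<in> parcs G" "u \<noteq> v"
  shows "gdist G u v = 1"
proof (rule antisym)
  have "awalk u [(u, v)] v"
    using assms by (auto simp: awalk_Cons_iff awalk_Nil_iff dest: wellformed')
  from gdist_le_length[OF this] show "gdist G u v \<le> 1" by (simp add: one_ereal_def)
  have "1 \<le> length p" if "awalk u p v" for p
    using that assms(2) by (cases p) (auto simp: awalk_Nil_iff)
  from gdist_geI[OF this] show "1 \<le> gdist G u v" by (simp add: one_ereal_def)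
qed

lemma gdist_two:
  assumes "(u, x) \<in> parcs G" "(x, v) \<in> parcs G" "(u, v) \<notin> parcs G" "u \<noteq> v"
  shows "gdist G u v = 2"
proof (rule antisym)
  have "awalk u [(u, x), (x, v)] v"
    using assms by (auto simp: awalk_Cons_iff awalk_Nil_iff dest: wellformed')
  from gdist_le_length[OF this] show "gdist G u v \<le> 2" by simp
  have "2 \<le> length p" if p: "awalk u p v" for p
  proof -
    have "p \<noteq> []" using p assms(4) by (auto simp: awalk_Nil_iff)
    moreover have "p \<noteq> [e]" for e
      using p assms(3) by (cases e) (auto simp: awalk_Cons_iff awalk_Nil_iff)
    ultimately show ?thesis by (cases p; cases "tl p") auto
  qed
  from gdist_geI[OF this] show "2 \<le> gdist G u v" by simp
qed

lemma gdist_le_diameter: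
  "u \<in> pverts G \<Longrightarrow> v \<in> pverts G \<Longrightarrow> gdist G u v \<le> diameter G"
  unfolding diameter_def ecc_def by (rule SUP_upper2, assumption, rule SUP_upper)

lemma gdist_finite_imp_awalk:
  assumes "gdist G u v \<noteq> \<infinity>"
  obtains p where "awalk u p v"
proof (rule ccontr)
  assume "\<not> thesis"
  then have "\<nexists>p. awalk u p v" using that by auto
  then show False
    using assms shortest_path_inf[of u v "\<lambda>_. 1"] by (simp add: gdist_def reachable_awalk)
qed

lemma finite_diameter_imp_awalk:
  assumes "diameter G \<noteq> \<infinity>" "u \<in> pverts G" "v \<in> pverts G"
  obtains p where "awalk u p v"
proof (rule gdist_finite_imp_awalk)
  show "gdist G u v \<noteq> \<infinity>" using gdist_le_diameter[OF assms(2,3)] assms(1) by auto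
qed

text \<open>
  Maximum principle: at a vertex where \<open>f\<close> attains its maximum all differences to the neighbours
  are nonnegative and sum to 0, so the maximum propagates along arcs, and by connectedness to
  every vertex.
\<close>
lemma harmonic_imp_constant:
  fixes f :: "'a \<Rightarrow> real"
  assumes fin: "finite (pverts G)" and diam: "diameter G \<noteq> \<infinity>"
    and harm: "\<And>v. v \<in> pverts G \<Longrightarrow> (\<Sum>w | w \<in> pverts G \<and> (v, w) \<in> parcs G. f v - f w) = 0"
  obtains c where "\<And>v. v \<in> pverts G \<Longrightarrow> f v = c"
proof (cases "pverts G = {}")
  case False
  define c where "c = Max (f ` pverts G)"
  have le: "f v \<le> c" if "v \<in> pverts G" for v using that fin by (simp add: c_def)
  have "c \<in> f ` pverts G" unfolding c_def using fin False by (intro Max_in) auto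
  then obtain v0 where v0: "v0 \<in> pverts G" "f v0 = c" by auto
  have step: "f w = c" if v: "f v = c" and vw: "(v, w) \<in> parcs G" for v w
  proof -
    let ?N = "{w. w \<in> pverts G \<and> (v, w) \<in> parcs G}"
    have "v \<in> pverts G" "w \<in> ?N" using vw by (auto dest: wellformed')
    moreover have "finite ?N" using fin by simp
    moreover have "0 \<le> f v - f x" if "x \<in> ?N" for x using le v that by auto
    ultimately have "f v - f w = 0"
      using harm[of v] sum_nonneg_0[of ?N "\<lambda>x. f v - f x" w] by simp
    then show ?thesis using v by simp
  qed
  have walk: "f w = c" if "awalk v p w" "f v = c" for v p w
    using that
  proof (induction p arbitrary: v)
    case (Cons e p)
    then show ?case using step[of v "snd e"] by (cases e) (auto simp: awalk_Cons_iff)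
  qed (auto simp: awalk_Nil_iff)
  have "f w = c" if w: "w \<in> pverts G" for w
  proof -
    obtain p where "awalk v0 p w" by (rule finite_diameter_imp_awalk[OF diam v0(1) w])
    then show ?thesis using v0(2) by (rule walk)
  qed
  then show ?thesis by (rule that)
qed (use that in blast)

end

lemma out_degree_eq_card:
  assumes "pair_wf_digraph G"
  shows "out_degree G v = card {w \<in> pverts G. (v, w) \<in> parcs G}"
proof -
  interpret pair_wf_digraph G by fact
  have "out_arcs G v = Pair v ` {w \<in> pverts G. (v, w) \<in> parcs G}"
    by (auto simp: out_arcs_def dest: wellformed')
  then show ?thesis unfolding out_degree_def by (simp add: card_image inj_on_def)
qed

text \<open>
  A vertex adjacent to all others has degree one less than the number of vertices. By regularity
  so has every vertex, and then all distances are at most 1.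
\<close>
lemma regular_diameter_two_non_neighbour:
  assumes "pair_graph G" "regular r G" "diameter G = 2" "v \<in> pverts G"
  obtains w where "w \<in> pverts G" "w \<noteq> v" "(v, w) \<notin> parcs G"
proof (rule ccontr)
  interpret pair_graph G by fact
  assume "\<not> thesis"
  then have all: "{w \<in> pverts G. (v, w) \<in> parcs G} = pverts G - {v}"
    using that no_loops' by blast
  have deg: "card {w \<in> pverts G. (x, w) \<in> parcs G} = r" if "x \<in> pverts G" for x
    using assms(2) that out_degree_eq_card[OF pair_wf_digraph] by (simp add: regular_def)
  have r: "r = card (pverts G) - 1" using deg[OF assms(4)] all assms(4) by simp
  have "gdist G x y \<le> 1" if x: "x \<in> pverts G" and y: "y \<in> pverts G" for x y
  proof (cases "x = y")
    case False
    have "{w \<in> pverts G. (x, w) \<in> parcs G} = pverts G - {x}"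
      using deg[OF x] r x pair_finite_verts no_loops'[of x x]
      by (intro card_subset_eq) auto
    then have "(x, y) \<in> parcs G" using y False by blast
    then show ?thesis using gdist_arc False by simp
  qed (use x gdist_self in simp)
  then have "diameter G \<le> 1" unfolding diameter_def ecc_def by (intro SUP_least)
  then show False using assms(3) by simp
qed

section \<open>Distances and eccentricities in a cone\<close>

lemma pverts_cone: "pverts (graph_join G K1) = Inl ` pverts G \<union> {Inr ()}"
  by (auto simp: graph_join_def K1_def)

lemma parcs_cone:
  "(Inl u, Inl v) \<in> parcs (graph_join G K1) \<longleftrightarrow> (u, v) \<in> parcs G"
  "(Inl u, Inr x) \<in> parcs (graph_join G K1) \<longleftrightarrow> u \<in> pverts G"
  "(Inr x, Inl u) \<in> parcs (graph_join G K1) \<longleftrightarrow> u \<in> pverts G"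
  "(Inr x, Inr y) \<notin> parcs (graph_join G K1)"
  by (auto simp: graph_join_def K1_def)

lemma pair_wf_digraph_cone:
  assumes "pair_wf_digraph G"
  shows "pair_wf_digraph (graph_join G K1)"
proof -
  interpret pair_wf_digraph G by fact
  show ?thesis
    by unfold_locales (auto simp: graph_join_def K1_def dest: wellformed')
qed

lemma gdist_cone:
  assumes "pair_graph G" "u \<in> pverts G" "v \<in> pverts G"
  shows "gdist (graph_join G K1) (Inl u) (Inl v)
      = (if u = v then 0 else if (u, v) \<in> parcs G then 1 else 2)"
proof -
  interpret pair_graph G by fact
  interpret H: pair_wf_digraph "graph_join G K1"
    by (rule pair_wf_digraph_cone) (rule pair_wf_digraph)
  show ?thesis
  proof (cases "u = v \<or> (u, v) \<in> parcs G")
    case True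
    then show ?thesis
      using assms(2) H.gdist_self[of "Inl u"] H.gdist_arc[of "Inl u" "Inl v"]
      by (auto simp: pverts_cone parcs_cone)
  next
    case False
    then have "gdist (graph_join G K1) (Inl u) (Inl v) = 2"
      by (intro H.gdist_two[of "Inl u" "Inr ()"]) (auto simp: assms(2,3) parcs_cone)
    then show ?thesis using False by simp
  qed
qed

lemma gdist_cone_apex:
  assumes "pair_graph G"
  shows "u \<in> pverts G \<Longrightarrow> gdist (graph_join G K1) (Inl u) (Inr ()) = 1"
    and "u \<in> pverts G \<Longrightarrow> gdist (graph_join G K1) (Inr ()) (Inl u) = 1"
    and "gdist (graph_join G K1) (Inr ()) (Inr ()) = 0"
proof -
  interpret pair_graph G by fact
  interpret H: pair_wf_digraph "graph_join G K1"
    by (rule pair_wf_digraph_cone) (rule pair_wf_digraph)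
  show "u \<in> pverts G \<Longrightarrow> gdist (graph_join G K1) (Inl u) (Inr ()) = 1"
    "u \<in> pverts G \<Longrightarrow> gdist (graph_join G K1) (Inr ()) (Inl u) = 1"
    "gdist (graph_join G K1) (Inr ()) (Inr ()) = 0"
    by (auto intro!: H.gdist_arc H.gdist_self simp: parcs_cone pverts_cone)
qed

text \<open>
  A non-neighbour is needed: a vertex adjacent to all others in \<open>G\<close> would have eccentricity 1 in
  the cone.
\<close>
lemma ecc_cone_base:
  assumes "pair_graph G" "v \<in> pverts G" "w \<in> pverts G" "w \<noteq> v" "(v, w) \<notin> parcs G"
  shows "ecc (graph_join G K1) (Inl v) = 2"
proof (rule antisym)
  show "ecc (graph_join G K1) (Inl v) \<le> 2"
    unfolding ecc_def using assms(1,2) by (intro SUP_least) (auto simp: pverts_cone gdist_cone gdist_cone_apex)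
  have "gdist (graph_join G K1) (Inl v) (Inl w) = 2" using assms by (simp add: gdist_cone)
  moreover have "Inl w \<in> pverts (graph_join G K1)" using assms by (simp add: pverts_cone)
  ultimately show "2 \<le> ecc (graph_join G K1) (Inl v)"
    unfolding ecc_def by (intro SUP_upper2[of "Inl w"]) simp_all
qed

lemma ecc_cone_apex:
  assumes "pair_graph G" "v \<in> pverts G"
  shows "ecc (graph_join G K1) (Inr ()) = 1"
proof (rule antisym)
  show "ecc (graph_join G K1) (Inr ()) \<le> 1"
    unfolding ecc_def using assms by (intro SUP_least) (auto simp: pverts_cone gdist_cone gdist_cone_apex)
  have "gdist (graph_join G K1) (Inr ()) (Inl v) = 1" using assms by (simp add: gdist_cone_apex)
  moreover have "Inl v \<in> pverts (graph_join G K1)" using assms by (simp add: pverts_cone)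
  ultimately show "1 \<le> ecc (graph_join G K1) (Inr ())"
    unfolding ecc_def by (intro SUP_upper2[of "Inl v"]) simp_all
qed

section \<open>Matrices acting on extended vectors\<close>

lemma eigenvectorI_index:
  assumes "A \<in> carrier_mat m m" "x \<in> carrier_vec m" "x \<noteq> 0\<^sub>v m"
    and "\<And>i. i < m \<Longrightarrow> (A *\<^sub>v x) $ i = k * x $ i"
  shows "eigenvector A x k"
proof -
  have "A *\<^sub>v x = k \<cdot>\<^sub>v x"
    using assms(1,2,4) by (intro eq_vecI) (simp_all del: index_mult_mat_vec)
  then show ?thesis using assms(1-3) by (simp add: eigenvector_def)
qed

lemma eigenvectorD_index:
  assumes "eigenvector A x k" "i < dim_row A"
  shows "(A *\<^sub>v x) $ i = k * x $ i"
  using assms by (auto simp: eigenvector_def simp del: index_mult_mat_vec)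

lemma mult_mat_vec_index_sum:
  fixes A :: "real mat"
  assumes "A \<in> carrier_mat m m" "x \<in> carrier_vec m" "i < m"
  shows "(A *\<^sub>v x) $ i = (\<Sum>j<m. A $$ (i, j) * x $ j)"
  using assms by (simp add: scalar_prod_def atLeast0LessThan)

lemma diagonal_mult_index:
  fixes x :: "real vec"
  assumes "x \<in> carrier_vec m" "i < m"
  shows "(\<Sum>j<m. (if i = j then d i else 0) * x $ j) = d i * x $ i"
proof -
  have "(\<Sum>j<m. (if i = j then d i else 0) * x $ j) = (\<Sum>j<m. if i = j then d i * x $ j else 0)"
    by (rule sum.cong) auto
  then show ?thesis using assms by simp
qed

lemma ecc_mat_carrier: "ecc_mat G vs \<in> carrier_mat (length vs) (length vs)"
  by (simp add: ecc_mat_def)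

lemma ecc_laplacian_carrier:
  "ecc_laplacian G vs \<in> carrier_mat (length vs) (length vs)"
  "ecc_signless_laplacian G vs \<in> carrier_mat (length vs) (length vs)"
  by (auto simp: ecc_laplacian_def ecc_signless_laplacian_def ecc_mat_def ecc_transmission_mat_def
      intro!: carrier_matI)

text \<open>
  The transmissions are the entries of the eccentricity matrix applied to the all-ones vector, so
  the action of both Laplacians is determined by the action of the eccentricity matrix alone.
\<close>
lemma ecc_laplacian_mult_index:
  fixes G :: "'a pair_pre_digraph" and vs :: "'a list" and i :: nat
  assumes x: "x \<in> carrier_vec (length vs)" and i: "i < length vs"
  defines "T \<equiv> (ecc_mat G vs *\<^sub>v ones_vec (length vs)) $ i"
  shows "(ecc_laplacian G vs *\<^sub>v x) $ i = T * x $ i - (ecc_mat G vs *\<^sub>v x) $ i"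
    and "(ecc_signless_laplacian G vs *\<^sub>v x) $ i = T * x $ i + (ecc_mat G vs *\<^sub>v x) $ i"
proof -
  let ?m = "length vs"
  let ?E = "ecc_mat G vs"
  have T: "T = (\<Sum>j<?m. ?E $$ (i, j))"
    using mult_mat_vec_index_sum[OF ecc_mat_carrier[of G vs], of "ones_vec ?m" i] i
    by (simp add: T_def)
  have L: "ecc_laplacian G vs $$ (i, j) = (if i = j then T else 0) - ?E $$ (i, j)"
    "ecc_signless_laplacian G vs $$ (i, j) = (if i = j then T else 0) + ?E $$ (i, j)"
    if "j < ?m" for j
    using that i ecc_mat_carrier[of G vs]
    by (simp_all add: ecc_laplacian_def ecc_signless_laplacian_def ecc_transmission_mat_def T)
  have "(ecc_laplacian G vs *\<^sub>v x) $ i = (\<Sum>j<?m. ((if i = j then T else 0) - ?E $$ (i, j)) * x $ j)"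
    unfolding mult_mat_vec_index_sum[OF ecc_laplacian_carrier(1) x i] using L by (intro sum.cong) auto
  then show "(ecc_laplacian G vs *\<^sub>v x) $ i = T * x $ i - (?E *\<^sub>v x) $ i"
    unfolding mult_mat_vec_index_sum[OF ecc_mat_carrier x i] left_diff_distrib sum_subtractf
    using diagonal_mult_index[OF x i, of "\<lambda>_. T"] by simp
  have "(ecc_signless_laplacian G vs *\<^sub>v x) $ i
      = (\<Sum>j<?m. ((if i = j then T else 0) + ?E $$ (i, j)) * x $ j)"
    unfolding mult_mat_vec_index_sum[OF ecc_laplacian_carrier(2) x i] using L by (intro sum.cong) auto
  then show "(ecc_signless_laplacian G vs *\<^sub>v x) $ i = T * x $ i + (?E *\<^sub>v x) $ i"
    unfolding mult_mat_vec_index_sum[OF ecc_mat_carrier x i] distrib_right sum.distrib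
    using diagonal_mult_index[OF x i, of "\<lambda>_. T"] by simp
qed

lemma extend_vec_carrier: "x \<in> carrier_vec n \<Longrightarrow> extend_vec x s \<in> carrier_vec (n + 1)"
  by (intro carrier_vecI) (simp add: carrier_vecD)

lemma extend_vec_nonzero:
  assumes "x \<in> carrier_vec n" "x \<noteq> 0\<^sub>v n"
  shows "extend_vec x s \<noteq> 0\<^sub>v (n + 1)"
proof
  assume eq: "extend_vec x s = 0\<^sub>v (n + 1)"
  have "x $ i = 0" if "i < n" for i
  proof -
    have "x $ i = extend_vec x s $ i" using carrier_vecD[OF assms(1)] that by simp
    then show ?thesis using that by (simp add: eq)
  qed
  then have "x = 0\<^sub>v n" using assms(1) by (intro eq_vecI) auto
  then show False using assms(2) by simp
qed

section \<open>Adjacency eigenvectors of a regular graph of diameter two\<close>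

locale regular_diameter_two =
  fixes G :: "'a pair_pre_digraph" and vs :: "'a list" and n r :: nat
  assumes graph: "pair_graph G"
    and distinct: "distinct vs" and set_vs: "set vs = pverts G" and len: "length vs = n"
    and regular: "regular r G"
    and diam: "diameter G = 2"
begin

interpretation pair_graph G by (fact graph)

abbreviation "A \<equiv> adj_mat G vs"
abbreviation "cone \<equiv> graph_join G K1"
abbreviation "cone_vs \<equiv> map Inl vs @ [Inr ()]"

lemma A_carrier: "A \<in> carrier_mat n n"
  using len by (simp add: adj_mat_def)

lemma vs_vertex: "i < n \<Longrightarrow> vs ! i \<in> pverts G"
  using nth_mem[of i vs] len set_vs by simp

lemma vs_inj: "i < n \<Longrightarrow> j < n \<Longrightarrow> vs ! i = vs ! j \<longleftrightarrow> i = j"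
  using distinct len by (simp add: nth_eq_iff_index_eq)

lemma sum_vertices: "(\<Sum>j<n. f (vs ! j)) = (\<Sum>v\<in>pverts G. f v)"
  using sum.reindex_bij_betw[OF bij_betw_nth[OF distinct refl refl], of f] len set_vs by simp

lemma n_pos: "0 < n"
proof (rule ccontr)
  assume "\<not> 0 < n"
  then have "pverts G = {}" using set_vs len by simp
  then show False using diam by (simp add: diameter_def bot_ereal_def)
qed

lemma neighbours: "v \<in> pverts G \<Longrightarrow> card {w \<in> pverts G. (v, w) \<in> parcs G} = r"
  using regular out_degree_eq_card[OF pair_wf_digraph] by (simp add: regular_def)

lemma A_mult_index:
  assumes "x \<in> carrier_vec n" "i < n"
  shows "(A *\<^sub>v x) $ i = (\<Sum>j<n. if (vs ! i, vs ! j) \<in> parcs G then x $ j else 0)"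
  unfolding mult_mat_vec_index_sum[OF A_carrier assms]
  by (rule sum.cong) (use assms(2) len in \<open>auto simp: adj_mat_def\<close>)

lemma A_row_sum:
  assumes "i < n"
  shows "(\<Sum>j<n. if (vs ! i, vs ! j) \<in> parcs G then c else 0) = real r * c"
proof -
  have "(\<Sum>j<n. if (vs ! i, vs ! j) \<in> parcs G then c else 0)
      = (\<Sum>w\<in>pverts G. if (vs ! i, w) \<in> parcs G then c else 0)"
    by (rule sum_vertices)
  also have "\<dots> = (\<Sum>w | w \<in> pverts G \<and> (vs ! i, w) \<in> parcs G. c)"
    by (rule sum.inter_filter[symmetric]) (rule pair_finite_verts)
  also have "\<dots> = real r * c" using neighbours[OF vs_vertex[OF assms]] by simp
  finally show ?thesis .
qed

lemma A_ones_index: "i < n \<Longrightarrow> (A *\<^sub>v ones_vec n) $ i = real r"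
  using A_mult_index[of "ones_vec n" i] A_row_sum[of i 1] by (simp cong: if_cong)

lemma laplacian_carrier:
  "laplacian G vs \<in> carrier_mat n n" "signless_laplacian G vs \<in> carrier_mat n n"
  using len by (auto simp: laplacian_def signless_laplacian_def deg_mat_def adj_mat_def
      intro!: carrier_matI)

lemma laplacian_mult_index:
  assumes x: "x \<in> carrier_vec n" and i: "i < n"
  shows "(laplacian G vs *\<^sub>v x) $ i = real r * x $ i - (A *\<^sub>v x) $ i"
    and "(signless_laplacian G vs *\<^sub>v x) $ i = real r * x $ i + (A *\<^sub>v x) $ i"
proof -
  have deg: "out_degree G (vs ! i) = r" using regular vs_vertex[OF i] by (simp add: regular_def)
  have L: "laplacian G vs $$ (i, j) = (if i = j then real r else 0) - A $$ (i, j)"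
    "signless_laplacian G vs $$ (i, j) = (if i = j then real r else 0) + A $$ (i, j)"
    if "j < n" for j
    using that i len deg
    by (auto simp: laplacian_def signless_laplacian_def deg_mat_def adj_mat_def)
  have "(laplacian G vs *\<^sub>v x) $ i = (\<Sum>j<n. ((if i = j then real r else 0) - A $$ (i, j)) * x $ j)"
    unfolding mult_mat_vec_index_sum[OF laplacian_carrier(1) x i] using L by (intro sum.cong) auto
  then show "(laplacian G vs *\<^sub>v x) $ i = real r * x $ i - (A *\<^sub>v x) $ i"
    unfolding mult_mat_vec_index_sum[OF A_carrier x i] left_diff_distrib sum_subtractf
    using diagonal_mult_index[OF x i, of "\<lambda>_. real r"] by simp
  have "(signless_laplacian G vs *\<^sub>v x) $ i
      = (\<Sum>j<n. ((if i = j then real r else 0) + A $$ (i, j)) * x $ j)"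
    unfolding mult_mat_vec_index_sum[OF laplacian_carrier(2) x i] using L by (intro sum.cong) auto
  then show "(signless_laplacian G vs *\<^sub>v x) $ i = real r * x $ i + (A *\<^sub>v x) $ i"
    unfolding mult_mat_vec_index_sum[OF A_carrier x i] distrib_right sum.distrib
    using diagonal_mult_index[OF x i, of "\<lambda>_. real r"] by simp
qed

lemma eigenvector_laplacian_imp_adj:
  assumes "eigenvector (laplacian G vs) x k"
  shows "eigenvector A x (real r - k)"
proof (rule eigenvectorI_index[OF A_carrier])
  show x: "x \<in> carrier_vec n" and "x \<noteq> 0\<^sub>v n"
    using assms laplacian_carrier by (auto simp: eigenvector_def)
  show "(A *\<^sub>v x) $ i = (real r - k) * x $ i" if "i < n" for i
    using eigenvectorD_index[OF assms] laplacian_mult_index(1)[OF x that] laplacian_carrier(1) that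
    by (simp add: left_diff_distrib del: index_mult_mat_vec)
qed

lemma eigenvector_signless_laplacian_imp_adj:
  assumes "eigenvector (signless_laplacian G vs) x k"
  shows "eigenvector A x (k - real r)"
proof (rule eigenvectorI_index[OF A_carrier])
  show x: "x \<in> carrier_vec n" and "x \<noteq> 0\<^sub>v n"
    using assms laplacian_carrier by (auto simp: eigenvector_def)
  show "(A *\<^sub>v x) $ i = (k - real r) * x $ i" if "i < n" for i
    using eigenvectorD_index[OF assms] laplacian_mult_index(2)[OF x that] laplacian_carrier(2) that
    by (simp add: left_diff_distrib del: index_mult_mat_vec)
qed

text \<open>
  Double counting: by symmetry the column sums of \<open>A\<close> are the degrees as well.
\<close>
lemma sum_A_mult:
  assumes x: "x \<in> carrier_vec n"
  shows "(\<Sum>i<n. (A *\<^sub>v x) $ i) = real r * (\<Sum>i<n. x $ i)"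
proof -
  have "(\<Sum>i<n. (A *\<^sub>v x) $ i) = (\<Sum>i<n. \<Sum>j<n. if (vs ! i, vs ! j) \<in> parcs G then x $ j else 0)"
    using A_mult_index[OF x] by (intro sum.cong) auto
  also have "\<dots> = (\<Sum>j<n. \<Sum>i<n. if (vs ! j, vs ! i) \<in> parcs G then x $ j else 0)"
    by (subst sum.swap) (auto intro!: sum.cong dest: arcs_symmetric)
  also have "\<dots> = (\<Sum>j<n. real r * x $ j)" using A_row_sum by (intro sum.cong) auto
  finally show ?thesis by (simp add: sum_distrib_left)
qed

text \<open>
  In a regular graph, $Ax = rx$ says that $x$, read as a function on the vertices, is harmonic.
\<close>
lemma adj_eigenvector_degree_imp_constant:
  assumes x: "x \<in> carrier_vec n" and eig: "\<And>i. i < n \<Longrightarrow> (A *\<^sub>v x) $ i = real r * x $ i"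
  obtains c where "x = c \<cdot>\<^sub>v ones_vec n"
proof -
  \<comment> \<open>the function on vertices whose value at \<open>vs ! i\<close> is \<open>x $ i\<close>\<close>
  define f where "f v = x $ (THE i. i < n \<and> vs ! i = v)" for v
  have f: "f (vs ! i) = x $ i" if "i < n" for i
  proof -
    have "(THE j. j < n \<and> vs ! j = vs ! i) = i" using that vs_inj by (intro the_equality) auto
    then show ?thesis by (simp add: f_def)
  qed
  have "(\<Sum>w | w \<in> pverts G \<and> (v, w) \<in> parcs G. f v - f w) = 0" if "v \<in> pverts G" for v
  proof -
    obtain i where i: "i < n" "v = vs ! i" using \<open>v \<in> pverts G\<close> set_vs len by (metis in_set_conv_nth)
    have "(\<Sum>w | w \<in> pverts G \<and> (v, w) \<in> parcs G. f v - f w)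
        = (\<Sum>w\<in>pverts G. if (v, w) \<in> parcs G then f v - f w else 0)"
      by (rule sum.inter_filter) (rule pair_finite_verts)
    also have "\<dots> = (\<Sum>j<n. if (v, vs ! j) \<in> parcs G then f v - f (vs ! j) else 0)"
      by (rule sum_vertices[symmetric])
    also have "\<dots> = (\<Sum>j<n. (if (vs ! i, vs ! j) \<in> parcs G then x $ i else 0)
        - (if (vs ! i, vs ! j) \<in> parcs G then x $ j else 0))"
      using i f by (intro sum.cong) auto
    also have "\<dots> = real r * x $ i - (A *\<^sub>v x) $ i"
      unfolding sum_subtractf A_row_sum[OF i(1)] A_mult_index[OF x i(1)] ..
    finally show ?thesis using eig[OF i(1)] by simp
  qed
  then obtain c where c: "\<And>v. v \<in> pverts G \<Longrightarrow> f v = c"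
    using harmonic_imp_constant[of f] pair_finite_verts diam by auto
  have "x = c \<cdot>\<^sub>v ones_vec n"
    using x f c vs_vertex by (intro eq_vecI) fastforce+
  then show ?thesis by (rule that)
qed

text \<open>
  Summing the entries of $Ax = kx$ gives $r \sum_i x_i = k \sum_i x_i$, so the sum is 0 unless
  $k = r$, and for $k = r$ the vector is constant.
\<close>
lemma adj_eigenvector_sum_zero:
  assumes eig: "eigenvector A x k" and "\<And>c. x \<noteq> c \<cdot>\<^sub>v ones_vec n"
  shows "(\<Sum>i<n. x $ i) = 0"
proof -
  have x: "x \<in> carrier_vec n" using eig A_carrier by (simp add: eigenvector_def)
  have Ax: "(A *\<^sub>v x) $ i = k * x $ i" if "i < n" for i
    using eigenvectorD_index[OF eig] A_carrier that by simp
  have "k \<noteq> real r" using adj_eigenvector_degree_imp_constant[OF x] Ax assms(2) by metis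
  moreover have "k * (\<Sum>i<n. x $ i) = real r * (\<Sum>i<n. x $ i)"
    using sum_A_mult[OF x] Ax by (simp add: sum_distrib_left)
  ultimately show ?thesis by simp
qed

section \<open>The eccentricity matrices of the cone\<close>

text \<open>
  Old vertices have eccentricity 2, so among them exactly the pairs at distance 2 survive. The
  apex has eccentricity 1, so its distance 1 to each old vertex is always kept.
\<close>
lemma ecc_mat_cone_index:
  assumes "i < n" "j < n"
  shows "ecc_mat cone cone_vs $$ (i, j) = 2 - (if i = j then 2 else 0) - 2 * A $$ (i, j)"
    and "ecc_mat cone cone_vs $$ (i, n) = 1"
    and "ecc_mat cone cone_vs $$ (n, j) = 1"
    and "ecc_mat cone cone_vs $$ (n, n) = 0"
proof -
  have ecc2: "ecc cone (Inl v) = 2" if "v \<in> pverts G" for v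
    by (rule regular_diameter_two_non_neighbour[OF graph regular diam that])
      (rule ecc_cone_base[OF graph that])
  have ecc1: "ecc cone (Inr ()) = 1"
    using ecc_cone_apex[OF graph vs_vertex[OF assms(1)]] .
  have v: "vs ! i \<in> pverts G" "vs ! j \<in> pverts G" using vs_vertex assms by auto
  have loop: "(vs ! j, vs ! j) \<notin> parcs G" using no_loops' by blast
  have hs: "cone_vs ! i = Inl (vs ! i)" "cone_vs ! j = Inl (vs ! j)" "cone_vs ! n = Inr ()" "length cone_vs = n + 1"
    using assms len by (simp_all add: nth_append)
  show "ecc_mat cone cone_vs $$ (i, j) = 2 - (if i = j then 2 else 0) - 2 * A $$ (i, j)"
    using assms len loop vs_inj[OF assms] gdist_cone[OF graph v] ecc2 v hs
    by (auto simp: ecc_mat_def adj_mat_def)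
  show "ecc_mat cone cone_vs $$ (i, n) = 1" "ecc_mat cone cone_vs $$ (n, j) = 1" "ecc_mat cone cone_vs $$ (n, n) = 0"
    using assms gdist_cone_apex[OF graph] ecc1 ecc2 v hs
    by (auto simp: ecc_mat_def)
qed

lemma ecc_mat_cone_mult:
  assumes x: "x \<in> carrier_vec n"
  shows "i < n \<Longrightarrow> (ecc_mat cone cone_vs *\<^sub>v extend_vec x s) $ i
      = 2 * (\<Sum>j<n. x $ j) - 2 * x $ i - 2 * (A *\<^sub>v x) $ i + s"
    and "(ecc_mat cone cone_vs *\<^sub>v extend_vec x s) $ n = (\<Sum>j<n. x $ j)"
proof -
  let ?E = "ecc_mat cone cone_vs"
  have E: "?E \<in> carrier_mat (n + 1) (n + 1)" using ecc_mat_carrier[of cone cone_vs] len by simp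
  have ext: "extend_vec x s $ j = x $ j" if "j < n" for j using carrier_vecD[OF x] that by simp
  have extn: "extend_vec x s $ n = s" using carrier_vecD[OF x] by simp
  have mult: "(?E *\<^sub>v extend_vec x s) $ i = (\<Sum>j<n. ?E $$ (i, j) * x $ j) + ?E $$ (i, n) * s"
    if "i < n + 1" for i
    using mult_mat_vec_index_sum[OF E extend_vec_carrier[OF x] that] ext extn by simp
  show "(?E *\<^sub>v extend_vec x s) $ n = (\<Sum>j<n. x $ j)"
    using mult[of n] ecc_mat_cone_index(3)[OF n_pos] ecc_mat_cone_index(4)[OF n_pos n_pos] by simp
  show "(?E *\<^sub>v extend_vec x s) $ i
      = 2 * (\<Sum>j<n. x $ j) - 2 * x $ i - 2 * (A *\<^sub>v x) $ i + s" if i: "i < n"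
  proof -
    have "(\<Sum>j<n. ?E $$ (i, j) * x $ j)
        = (\<Sum>j<n. 2 * x $ j - (if i = j then 2 else 0) * x $ j - 2 * (A $$ (i, j) * x $ j))"
      using ecc_mat_cone_index(1)[OF i] by (intro sum.cong) (simp_all add: left_diff_distrib)
    also have "\<dots> = 2 * (\<Sum>j<n. x $ j) - 2 * x $ i - 2 * (A *\<^sub>v x) $ i"
      unfolding sum_subtractf diagonal_mult_index[OF x i, of "\<lambda>_. 2"]
        mult_mat_vec_index_sum[OF A_carrier x i] sum_distrib_left ..
    finally show ?thesis using mult[of i] ecc_mat_cone_index(2)[OF i i] i by simp
  qed
qed

text \<open>
  The constants \<open>2 * n - 2 * r - 1\<close> and \<open>n\<close> in front of \<open>x $ i\<close> and \<open>s\<close> are the transmissions of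
  an old vertex and of the apex.
\<close>
lemma cone_mult:
  assumes x: "x \<in> carrier_vec n"
  shows "i < n \<Longrightarrow> (ecc_laplacian cone cone_vs *\<^sub>v extend_vec x s) $ i
      = (2 * real n - 2 * real r - 1) * x $ i - (2 * (\<Sum>j<n. x $ j) - 2 * x $ i - 2 * (A *\<^sub>v x) $ i + s)"
    and "(ecc_laplacian cone cone_vs *\<^sub>v extend_vec x s) $ n = real n * s - (\<Sum>j<n. x $ j)"
    and "i < n \<Longrightarrow> (ecc_signless_laplacian cone cone_vs *\<^sub>v extend_vec x s) $ i
      = (2 * real n - 2 * real r - 1) * x $ i + (2 * (\<Sum>j<n. x $ j) - 2 * x $ i - 2 * (A *\<^sub>v x) $ i + s)"
    and "(ecc_signless_laplacian cone cone_vs *\<^sub>v extend_vec x s) $ n = real n * s + (\<Sum>j<n. x $ j)"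
proof -
  have hs: "length cone_vs = n + 1" using len by simp
  have ext: "extend_vec x s \<in> carrier_vec (length cone_vs)" using extend_vec_carrier[OF x] hs by simp
  have ext_index: "i < n \<Longrightarrow> extend_vec x s $ i = x $ i" "extend_vec x s $ n = s" for i
    using carrier_vecD[OF x] by simp_all
  have ones: "ones_vec (length cone_vs) = extend_vec (ones_vec n) 1"
    using hs by (intro eq_vecI) (auto simp: less_Suc_eq)
  have T: "(ecc_mat cone cone_vs *\<^sub>v ones_vec (length cone_vs)) $ i = 2 * real n - 2 * real r - 1" if "i < n" for i
    unfolding ones ecc_mat_cone_mult(1)[OF vec_carrier that] A_ones_index[OF that] using that by simp
  have Tn: "(ecc_mat cone cone_vs *\<^sub>v ones_vec (length cone_vs)) $ n = real n"
    unfolding ones ecc_mat_cone_mult(2)[OF vec_carrier] by simp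
  show "(ecc_laplacian cone cone_vs *\<^sub>v extend_vec x s) $ n = real n * s - (\<Sum>j<n. x $ j)"
    "(ecc_signless_laplacian cone cone_vs *\<^sub>v extend_vec x s) $ n = real n * s + (\<Sum>j<n. x $ j)"
    using ecc_laplacian_mult_index[OF ext, of n cone] hs
    unfolding Tn ext_index ecc_mat_cone_mult(2)[OF x] by simp_all
  show "(ecc_laplacian cone cone_vs *\<^sub>v extend_vec x s) $ i
      = (2 * real n - 2 * real r - 1) * x $ i - (2 * (\<Sum>j<n. x $ j) - 2 * x $ i - 2 * (A *\<^sub>v x) $ i + s)"
    "(ecc_signless_laplacian cone cone_vs *\<^sub>v extend_vec x s) $ i
      = (2 * real n - 2 * real r - 1) * x $ i + (2 * (\<Sum>j<n. x $ j) - 2 * x $ i - 2 * (A *\<^sub>v x) $ i + s)"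
    if "i < n"
    using ecc_laplacian_mult_index[OF ext, of i cone] hs that
    unfolding T[OF that] ext_index(1)[OF that] ecc_mat_cone_mult(1)[OF x that] by simp_all
qed

lemma cone_carrier:
  "ecc_laplacian cone cone_vs \<in> carrier_mat (n + 1) (n + 1)"
  "ecc_signless_laplacian cone cone_vs \<in> carrier_mat (n + 1) (n + 1)"
  using ecc_laplacian_carrier[where G = cone and vs = cone_vs] len by simp_all

lemma eigenvector_extendI:
  assumes B: "B \<in> carrier_mat (n + 1) (n + 1)"
    and x: "x \<in> carrier_vec n" "x \<noteq> 0\<^sub>v n"
    and base: "\<And>i. i < n \<Longrightarrow> (B *\<^sub>v extend_vec x s) $ i = k * x $ i"
    and apex: "(B *\<^sub>v extend_vec x s) $ n = k * s"
  shows "eigenvector B (extend_vec x s) k"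
proof (rule eigenvectorI_index[OF B extend_vec_carrier[OF x(1)] extend_vec_nonzero[OF x]])
  fix i assume "i < n + 1"
  then show "(B *\<^sub>v extend_vec x s) $ i = k * extend_vec x s $ i"
    using base[of i] apex carrier_vecD[OF x(1)]
    by (cases "i < n") (simp_all del: index_mult_mat_vec add: less_Suc_eq)
qed

text \<open>
  With entry sum 0 the apex coordinate of the image is 0, and an old coordinate keeps only the
  transmission, the identity part and the adjacency part of the matrix, all of which scale \<open>x\<close>.
\<close>
lemma cone_eigenvector_base:
  assumes eig: "eigenvector A x k" and sum0: "(\<Sum>i<n. x $ i) = 0"
  shows "eigenvector (ecc_laplacian cone cone_vs) (extend_vec x 0) (2 * real n - 2 * real r + 1 + 2 * k)"
    and "eigenvector (ecc_signless_laplacian cone cone_vs) (extend_vec x 0) (2 * real n - 2 * real r - 3 - 2 * k)"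
proof -
  have x: "x \<in> carrier_vec n" "x \<noteq> 0\<^sub>v n" using eig A_carrier by (auto simp: eigenvector_def)
  have Ax: "(A *\<^sub>v x) $ i = k * x $ i" if "i < n" for i
    using eigenvectorD_index[OF eig] A_carrier that by simp
  show "eigenvector (ecc_laplacian cone cone_vs) (extend_vec x 0) (2 * real n - 2 * real r + 1 + 2 * k)"
    by (rule eigenvector_extendI[OF cone_carrier(1) x])
      (simp_all add: cone_mult[OF x(1)] sum0 Ax algebra_simps del: index_mult_mat_vec)
  show "eigenvector (ecc_signless_laplacian cone cone_vs) (extend_vec x 0) (2 * real n - 2 * real r - 3 - 2 * k)"
    by (rule eigenvector_extendI[OF cone_carrier(2) x])
      (simp_all add: cone_mult[OF x(1)] sum0 Ax algebra_simps del: index_mult_mat_vec)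
qed

lemma ones_nonzero: "ones_vec n \<noteq> 0\<^sub>v n"
proof
  assume "ones_vec n = 0\<^sub>v n"
  then have "ones_vec n $ 0 = 0\<^sub>v n $ 0" by simp
  then show False using n_pos by simp
qed

text \<open>
  On $(\mathbf{1}, s)$ all old coordinates of the image agree, which leaves one equation for the
  old vertices and one for the apex.
\<close>
lemma cone_eigenvector_ones:
  shows "1 - s = t \<Longrightarrow> real n * s - real n = t * s \<Longrightarrow>
      eigenvector (ecc_laplacian cone cone_vs) (extend_vec (ones_vec n) s) t"
    and "4 * real n - 4 * real r - 3 + s = t \<Longrightarrow> real n * s + real n = t * s \<Longrightarrow>
      eigenvector (ecc_signless_laplacian cone cone_vs) (extend_vec (ones_vec n) s) t"
proof -
  show "eigenvector (ecc_laplacian cone cone_vs) (extend_vec (ones_vec n) s) t"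
    if "1 - s = t" "real n * s - real n = t * s"
    by (rule eigenvector_extendI[OF cone_carrier(1) vec_carrier ones_nonzero])
      (use that in \<open>simp_all add: cone_mult[OF vec_carrier] A_ones_index del: index_mult_mat_vec\<close>)
  show "eigenvector (ecc_signless_laplacian cone cone_vs) (extend_vec (ones_vec n) s) t"
    if "4 * real n - 4 * real r - 3 + s = t" "real n * s + real n = t * s"
    by (rule eigenvector_extendI[OF cone_carrier(2) vec_carrier ones_nonzero])
      (use that in \<open>simp_all add: cone_mult[OF vec_carrier] A_ones_index del: index_mult_mat_vec\<close>)
qed

lemma eigensystem_cone:
  assumes ind: "lin_indpt_family n (us @ [ones_vec n])" and dim: "length us + 1 = n"
    and us: "list_all2 (\<lambda>x e. eigenvector B (extend_vec x 0) e) us es"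
    and B: "B \<in> carrier_mat (n + 1) (n + 1)"
    and s: "eigenvector B (extend_vec (ones_vec n) s) k"
    and t: "eigenvector B (extend_vec (ones_vec n) t) l"
    and "s \<noteq> t"
  shows "eigensystem B (es @ [k, l])
    (map (\<lambda>x. extend_vec x 0) us @ [extend_vec (ones_vec n) s, extend_vec (ones_vec n) t])"
proof (rule eigensystemI[OF B])
  show "lin_indpt_family (n + 1)
      (map (\<lambda>x. extend_vec x 0) us @ [extend_vec (ones_vec n) s, extend_vec (ones_vec n) t])"
    using ind \<open>s \<noteq> t\<close> by (rule lin_indpt_family_extend)
  show "list_all2 (eigenvector B)
      (map (\<lambda>x. extend_vec x 0) us @ [extend_vec (ones_vec n) s, extend_vec (ones_vec n) t])
      (es @ [k, l])"
    using us s t by (intro list_all2_appendI) (simp_all add: list_all2_map1)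
qed (use dim in simp)

end

section \<open>Zeros of the quadratic and the spectra of the cone\<close>

text \<open>
  A monic quadratic with a negative value somewhere has positive discriminant, hence splits over
  the reals.
\<close>
lemma proots_monic_quadratic:
  fixes b c x :: real
  assumes neg: "x\<^sup>2 - b * x + c < 0"
  obtains t1 t2 where "proots [:c, - b, 1:] = {#t1, t2#}" "t1 + t2 = b" "t1 * t2 = c"
proof -
  define d where "d = sqrt (b\<^sup>2 - 4 * c)"
  have "0 \<le> (2 * x - b)\<^sup>2" by simp
  also have "(2 * x - b)\<^sup>2 = (b\<^sup>2 - 4 * c) + 4 * (x\<^sup>2 - b * x + c)"
    by (simp add: power2_eq_square algebra_simps)
  also have "\<dots> \<le> b\<^sup>2 - 4 * c" using neg by (simp only: add_le_same_cancel1) simp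
  finally have "0 \<le> b\<^sup>2 - 4 * c" .
  then have d2: "d\<^sup>2 = b\<^sup>2 - 4 * c" by (simp add: d_def)
  define t1 t2 where "t1 = (b + d) / 2" and "t2 = (b - d) / 2"
  have "t1 * t2 = (b\<^sup>2 - d\<^sup>2) / 4"
    by (simp add: t1_def t2_def power2_eq_square algebra_simps)
  then have prod: "t1 * t2 = c" using d2 by simp
  have sum: "t1 + t2 = b" by (simp add: t1_def t2_def field_simps)
  have "[:c, - b, 1:] = [:- t1, 1:] * [:- t2, 1:]" by (simp add: sum[symmetric] prod[symmetric])
  also have "proots \<dots> = proots [:- t1, 1:] + proots [:- t2, 1:]" by (rule proots_mult) simp_all
  finally have "proots [:c, - b, 1:] = {#t1, t2#}" by simp
  then show thesis using sum prod that by blast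
qed

lemma vieta_monic_quadratic:
  fixes b c x :: real
  assumes "x\<^sup>2 - b * x + c < 0" and eq: "proots [:c, - b, 1:] = {#t1, t2#}"
  shows "t1 + t2 = b" "t1 * t2 = c"
proof -
  obtain s1 s2 where s: "proots [:c, - b, 1:] = {#s1, s2#}" "s1 + s2 = b" "s1 * s2 = c"
    using proots_monic_quadratic[OF assms(1)] .
  then have "s1 = t1 \<and> s2 = t2 \<or> s1 = t2 \<and> s2 = t1"
    using eq by (auto simp: add_eq_conv_ex)
  then show "t1 + t2 = b" "t1 * t2 = c" using s by (auto simp: algebra_simps)
qed

lemma eigensystem_mapD:
  assumes "eigensystem A (map \<mu> is) (map u is)" "i \<in> set is"
  shows "eigenvector A (u i) (\<mu> i)"
  using assms by (simp add: eigensystem_def list_all2_map1 list_all2_map2 list_all2_same)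

theorem theorem3p2:
  fixes G :: "'a pair_pre_digraph" and vs :: "'a list" and n r :: nat
    and \<mu> q :: "nat \<Rightarrow> real" and u w :: "nat \<Rightarrow> real vec"
  assumes "pair_graph G"
    and "distinct vs" and "set vs = pverts G" and "card (pverts G) = n"
    and "regular r G"
    and "diameter G = 2"
    and "eigensystem (laplacian G vs) (map \<mu> [1..<n+1]) (map u [1..<n+1])"
    and "u n = ones_vec n"
    and "eigensystem (signless_laplacian G vs) (map q [1..<n+1]) (map w [1..<n+1])"
    and "w 1 = ones_vec n"
  defines "H \<equiv> graph_join G K1" and "hs \<equiv> map Inl vs @ [Inr ()]"
  defines "p \<equiv> [: 4 * real n * (real n - real r - 1), - (5 * real n - 4 * real r - 3), 1 :]"
  shows
    "eigensystem (ecc_laplacian H hs)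
       (map (\<lambda>i. 2 * real n + 1 - 2 * \<mu> i) [1..<n] @ [0, real n + 1])
       (map (\<lambda>i. extend_vec (u i) 0) [1..<n]
          @ [extend_vec (u n) 1, extend_vec (u n) (- real n)])
     \<and> (\<exists>t1 t2. proots p = {#t1, t2#})
     \<and> (\<forall>t1 t2 \<alpha>1 \<alpha>2. proots p = {#t1, t2#} \<longrightarrow>
          \<alpha>1 = real n / (t1 - real n) \<longrightarrow> \<alpha>2 = - (real n / \<alpha>1) \<longrightarrow>
          eigensystem (ecc_signless_laplacian H hs)
            (map (\<lambda>i. 2 * real n - 3 - 2 * q i) [2..<n+1] @ [t1, t2])
            (map (\<lambda>i. extend_vec (w i) 0) [2..<n+1]
               @ [extend_vec (w 1) \<alpha>1, extend_vec (w 1) \<alpha>2]))"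
proof -
  have len: "length vs = n" using assms(2-4) distinct_card by metis
  interpret regular_diameter_two G vs n r
    by (rule regular_diameter_two.intro) (fact assms len)+
  let ?b = "5 * real n - 4 * real r - 3" and ?c = "4 * real n * (real n - real r - 1)"
  \<comment> \<open>a negative value of the quadratic at \<open>n\<close>, so its two zeros are real and differ from \<open>n\<close>\<close>
  have "(real n)\<^sup>2 - ?b * real n + ?c = - real n"
    by (simp add: power2_eq_square algebra_simps)
  then have neg: "(real n)\<^sup>2 - ?b * real n + ?c < 0" using n_pos by simp
  have indu: "lin_indpt_family n (map u [1..<n+1])"
    using assms(7) laplacian_carrier(1) by (simp add: eigensystem_def del: upt_Suc)
  have indw: "lin_indpt_family n (map w [1..<n+1])"
    using assms(9) laplacian_carrier(2) by (simp add: eigensystem_def del: upt_Suc)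
  have not_ones: "y i \<noteq> c \<cdot>\<^sub>v ones_vec n"
    if ind: "lin_indpt_family n (map y [1..<n+1])" and "y j = ones_vec n"
      and ij: "i \<in> {1..n}" "j \<in> {1..n}" "i \<noteq> j"
    for y :: "nat \<Rightarrow> real vec" and i j c
  proof -
    have "map y [1..<n+1] ! (i - 1) = y i" if "i \<in> {1..n}" for i
      using that by (subst nth_map) (auto simp del: upt_Suc)
    then show ?thesis
      using lin_indpt_family_not_multiple[OF ind, of "i - 1" "j - 1" c] that by fastforce
  qed
  have eigL: "eigensystem (ecc_laplacian H hs)
       (map (\<lambda>i. 2 * real n + 1 - 2 * \<mu> i) [1..<n] @ [0, real n + 1])
       (map (\<lambda>x. extend_vec x 0) (map u [1..<n])
          @ [extend_vec (ones_vec n) 1, extend_vec (ones_vec n) (- real n)])"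
    unfolding H_def hs_def
  proof (rule eigensystem_cone)
    show "lin_indpt_family n (map u [1..<n] @ [ones_vec n])"
      using indu assms(8) n_pos by simp
    show "list_all2 (\<lambda>x. eigenvector (ecc_laplacian cone cone_vs) (extend_vec x 0)) (map u [1..<n])
        (map (\<lambda>i. 2 * real n + 1 - 2 * \<mu> i) [1..<n])"
      unfolding list_all2_map1 list_all2_map2 list_all2_same
    proof
      fix i assume i: "i \<in> set [1..<n]"
      then have "eigenvector (laplacian G vs) (u i) (\<mu> i)"
        using eigensystem_mapD[OF assms(7)] by simp
      then have eig: "eigenvector A (u i) (real r - \<mu> i)" by (rule eigenvector_laplacian_imp_adj)
      have "(\<Sum>k<n. u i $ k) = 0"
        by (rule adj_eigenvector_sum_zero[OF eig not_ones[OF indu assms(8)]]) (use i in auto)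
      from cone_eigenvector_base(1)[OF eig this]
      show "eigenvector (ecc_laplacian cone cone_vs) (extend_vec (u i) 0) (2 * real n + 1 - 2 * \<mu> i)"
        by (simp add: algebra_simps)
    qed
    show "eigenvector (ecc_laplacian cone cone_vs) (extend_vec (ones_vec n) 1) 0"
      "eigenvector (ecc_laplacian cone cone_vs) (extend_vec (ones_vec n) (- real n)) (real n + 1)"
      by (rule cone_eigenvector_ones(1); simp add: algebra_simps)+
    show "ecc_laplacian cone cone_vs \<in> carrier_mat (n + 1) (n + 1)" by (rule cone_carrier(1))
    show "1 \<noteq> - real n" by simp
  qed (use n_pos in simp)
  have eigQ: "eigensystem (ecc_signless_laplacian H hs)
       (map (\<lambda>i. 2 * real n - 3 - 2 * q i) [2..<n+1] @ [t1, t2])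
       (map (\<lambda>x. extend_vec x 0) (map w [2..<n+1])
          @ [extend_vec (ones_vec n) \<alpha>1, extend_vec (ones_vec n) \<alpha>2])"
    if roots: "proots p = {#t1, t2#}"
      and \<alpha>1: "\<alpha>1 = real n / (t1 - real n)" and \<alpha>2: "\<alpha>2 = - (real n / \<alpha>1)"
    for t1 t2 \<alpha>1 \<alpha>2
  proof -
    have sum: "t1 + t2 = ?b" and prod: "t1 * t2 = ?c"
      using vieta_monic_quadratic[OF neg roots[unfolded p_def]] by simp_all
    \<comment> \<open>again the value of the quadratic at \<open>n\<close>, now in factored form; it links \<open>\<alpha>1\<close> to \<open>t2\<close> and \<open>\<alpha>2\<close> to \<open>t1\<close>\<close>
    have "(t1 - n) * (t2 - n) = t1 * t2 - (t1 + t2) * n + real n * n"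
      by (simp add: algebra_simps)
    also have "\<dots> = - real n" unfolding sum prod by (simp add: algebra_simps)
    finally have tn: "(t1 - n) * (t2 - n) = - real n" .
    then have ne: "t1 - n \<noteq> 0" using n_pos by auto
    have a2: "\<alpha>2 = n - t1" using \<alpha>1 \<alpha>2 ne n_pos by simp
    have e1: "\<alpha>1 * (t1 - n) = n" using \<alpha>1 ne by simp
    then have "(\<alpha>1 + (t2 - n)) * (t1 - n) = 0" using tn by (simp add: algebra_simps)
    then have a1: "\<alpha>1 = n - t2" using ne by simp
    have e2: "\<alpha>2 * (t2 - n) = n" using tn unfolding a2 by (simp add: algebra_simps)
    show ?thesis
      unfolding H_def hs_def
    proof (rule eigensystem_cone)
      \<comment> \<open>here the all-ones vector comes first in the family, so it is moved to the end\<close>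
      have "[1..<n+1] = 1 # [2..<n+1]" using n_pos by (simp add: upt_rec numeral_2_eq_2)
      then have "mset (map w [1..<n+1]) = mset (map w [2..<n+1] @ [ones_vec n])"
        using assms(10) by simp
      from lin_indpt_family_mset_cong[OF this]
      show "lin_indpt_family n (map w [2..<n+1] @ [ones_vec n])" using indw by simp
      show "list_all2 (\<lambda>x. eigenvector (ecc_signless_laplacian cone cone_vs) (extend_vec x 0))
          (map w [2..<n+1]) (map (\<lambda>i. 2 * real n - 3 - 2 * q i) [2..<n+1])"
        unfolding list_all2_map1 list_all2_map2 list_all2_same
      proof
        fix i assume i: "i \<in> set [2..<n+1]"
        then have "eigenvector (signless_laplacian G vs) (w i) (q i)"
          by (intro eigensystem_mapD[OF assms(9)]) (auto simp del: upt_Suc)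
        then have eig: "eigenvector A (w i) (q i - real r)"
          by (rule eigenvector_signless_laplacian_imp_adj)
        have "(\<Sum>k<n. w i $ k) = 0"
          by (rule adj_eigenvector_sum_zero[OF eig not_ones[OF indw assms(10)]]) (use i in auto)
        from cone_eigenvector_base(2)[OF eig this]
        show "eigenvector (ecc_signless_laplacian cone cone_vs) (extend_vec (w i) 0)
            (2 * real n - 3 - 2 * q i)"
          by (simp add: algebra_simps)
      qed
      show "eigenvector (ecc_signless_laplacian cone cone_vs) (extend_vec (ones_vec n) \<alpha>1) t1"
      proof (rule cone_eigenvector_ones(2))
        show "4 * real n - 4 * real r - 3 + \<alpha>1 = t1" using sum a1 by simp
        show "real n * \<alpha>1 + real n = t1 * \<alpha>1" using e1 by (simp add: algebra_simps)
      qed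
      show "eigenvector (ecc_signless_laplacian cone cone_vs) (extend_vec (ones_vec n) \<alpha>2) t2"
      proof (rule cone_eigenvector_ones(2))
        show "4 * real n - 4 * real r - 3 + \<alpha>2 = t2" using sum a2 by simp
        show "real n * \<alpha>2 + real n = t2 * \<alpha>2" using e2 by (simp add: algebra_simps)
      qed
      show "ecc_signless_laplacian cone cone_vs \<in> carrier_mat (n + 1) (n + 1)" by (rule cone_carrier(2))
      show "\<alpha>1 \<noteq> \<alpha>2"
      proof
        assume "\<alpha>1 = \<alpha>2"
        then have "(t1 - n) * (t1 - n) = - real n" using tn a1 a2 by simp
        moreover have "0 \<le> (t1 - n) * (t1 - n)" by simp
        ultimately show False using n_pos by linarith
      qed
    qed (use n_pos in \<open>simp del: upt_Suc\<close>)
  qed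
  have "\<exists>t1 t2. proots p = {#t1, t2#}"
    using proots_monic_quadratic[OF neg] unfolding p_def by metis
  then show ?thesis using eigL eigQ assms(8,10) by (simp add: o_def del: upt_Suc)
qed

end
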